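(* Let $n>1$ be a square-free positive integer. Let $\sigma$ be the cycle $(2\,3\,\cdots\,n)$ in the symmetric group on $\{1,\dots,n\}$, and for $0\le i\le n-2$ let $F_i$ be the $n\times n$ permutation matrix of $\sigma^i$. Then $\{F_0,\dots,F_{n-2}\}$ is a maximal set of $n-1$ mutually orthogonal binary frequency squares of type $(n;n-1,1)$.
   Context: A frequency square of type $(n;\lambda_0,\dots,\lambda_{m-1})$ (with $m\ge 2$, all $\lambda_i\ge1$, $\sum\lambda_i=n$) is an $n\times n$ array on symbols $\{0,\dots,m-1\}$ in which symbol $i$ occurs exactly $\lambda_i$ times in each row and each column. It is binary if $m=2$. Two frequency squares $F,F'$ of types $(n;\lambda_0,\dots,\lambda_{m_1-1})$ and $(n;\mu_0,\dots,\mu_{m_2-1})$ are orthogonal if, when superimposed, each ordered pair $(i,j)$ occurs in exactly $\lambda_i\mu_j$ cells. A set of mutually orthogonal frequency squares (MOFS) is a set of pairwise orthogonal frequency squares. A set $\{F_1,\dots,F_k\}$ of MOFS is maximal if there is no frequency square $F$ (of any type, with at least two symbols) that is orthogonal to $F_i$ for every $1\le i\le k$. *)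

theory Defs
  imports
    "HOL-Library.FuncSet"
    "HOL-Combinatorics.Cycles"
    "HOL-Computational_Algebra.Squarefree"
begin

text \<open>An \<open>n \<times> n\<close> array has rows and columns indexed by \<open>{1..n}\<close>. Arrays are extensional
  functions, so that two arrays are equal iff their entries agree. The list \<open>ls\<close> holds
  \<open>\<lambda>\<^sub>0, \<dots>, \<lambda>\<^sub>m\<^sub>-\<^sub>1\<close>.\<close>

definition frequency_square :: "nat \<Rightarrow> nat list \<Rightarrow> (nat \<times> nat \<Rightarrow> nat) \<Rightarrow> bool" where
  "frequency_square n ls F \<longleftrightarrow>
     length ls \<ge> 2 \<and> (\<forall>l\<in>set ls. l \<ge> 1) \<and> sum_list ls = n \<and>
     F \<in> {1..n} \<times> {1..n} \<rightarrow>\<^sub>E {..<length ls} \<and>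
     (\<forall>s<length ls.
        (\<forall>r\<in>{1..n}. card {c \<in> {1..n}. F (r, c) = s} = ls ! s) \<and>
        (\<forall>c\<in>{1..n}. card {r \<in> {1..n}. F (r, c) = s} = ls ! s))"

text \<open>The type of a frequency square is determined by the square, so the existential
  quantifier over the types in the next definition involves no choice.\<close>

definition fs_orthogonal :: "nat \<Rightarrow> (nat \<times> nat \<Rightarrow> nat) \<Rightarrow> (nat \<times> nat \<Rightarrow> nat) \<Rightarrow> bool" where
  "fs_orthogonal n F G \<longleftrightarrow>
     (\<exists>ls ms. frequency_square n ls F \<and> frequency_square n ms G \<and>
        (\<forall>i<length ls. \<forall>j<length ms.
           card {x \<in> {1..n} \<times> {1..n}. F x = i \<and> G x = j} = ls ! i * ms ! j))"

definition mofs :: "nat \<Rightarrow> (nat \<times> nat \<Rightarrow> nat) set \<Rightarrow> bool" where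
  "mofs n S \<longleftrightarrow> (\<forall>F\<in>S. \<exists>ls. frequency_square n ls F) \<and> pairwise (fs_orthogonal n) S"

definition maximal_mofs :: "nat \<Rightarrow> (nat \<times> nat \<Rightarrow> nat) set \<Rightarrow> bool" where
  "maximal_mofs n S \<longleftrightarrow>
     mofs n S \<and> (\<nexists>F. (\<exists>ls. frequency_square n ls F) \<and> (\<forall>G\<in>S. fs_orthogonal n F G))"

definition perm_matrix :: "nat \<Rightarrow> (nat \<Rightarrow> nat) \<Rightarrow> nat \<times> nat \<Rightarrow> nat" where
  "perm_matrix n p = (\<lambda>(r, c) \<in> {1..n} \<times> {1..n}. if p r = c then 1 else 0)"

end

theory Submission
  imports Defs "HOL-Number_Theory.Cong"
begin

text \<open>Every cell \<open>(r, c)\<close> with \<open>r, c \<ge> 2\<close> is covered by exactly one of the permutation matrices,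
  the cell \<open>(1, 1)\<close> by all of them, and no other cell by any. Suppose a frequency square in which
  symbol \<open>s\<close> has frequency \<open>\<lambda>\<close> is orthogonal to all of them, and let \<open>\<delta>\<close> be 1 if \<open>s\<close> is in cell
  \<open>(1, 1)\<close> and 0 otherwise. Counting the occurrences of \<open>s\<close> on the \<open>n - 1\<close> matrices in two ways gives
  \<open>(n - 1) \<lambda> = (n - 1) \<delta> + (n \<lambda> - 2 \<lambda> + \<delta>)\<close>, hence \<open>\<lambda> = n \<delta>\<close>. So every symbol is in cell
  \<open>(1, 1)\<close>, which is impossible with two symbols.\<close>

lemma frequency_square_nth_pos:
  assumes "frequency_square n ls G" "s < length ls"
  shows "ls ! s > 0"
  using assms(1) nth_mem[OF assms(2)] unfolding frequency_square_def
  by (metis One_nat_def Suc_le_lessD)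

section \<open>Permutation matrices as binary frequency squares\<close>

lemma perm_matrix_eq:
  assumes "r \<in> {1..n}" "c \<in> {1..n}"
  shows "perm_matrix n p (r, c) = 1 \<longleftrightarrow> p r = c" "perm_matrix n p (r, c) = 0 \<longleftrightarrow> p r \<noteq> c"
  using assms by (simp_all add: perm_matrix_def)

lemma frequency_square_perm_matrix:
  assumes "n > 1" and p: "p permutes {1..n}"
  shows "frequency_square n [n - 1, 1] (perm_matrix n p)"
proof -
  have row1: "card {c \<in> {1..n}. perm_matrix n p (r, c) = 1} = 1" if r: "r \<in> {1..n}" for r
  proof -
    have "{c \<in> {1..n}. perm_matrix n p (r, c) = 1} = {p r}"
      using r permutes_in_image[OF p, of r]
      by (auto simp: perm_matrix_eq simp del: One_nat_def atLeastAtMost_iff)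
    then show ?thesis by simp
  qed
  have col1: "card {r \<in> {1..n}. perm_matrix n p (r, c) = 1} = 1" if c: "c \<in> {1..n}" for c
  proof -
    have "{r \<in> {1..n}. perm_matrix n p (r, c) = 1} = {inv p c}"
      using c permutes_in_image[OF permutes_inv[OF p], of c] permutes_inverses[OF p]
      by (auto simp: perm_matrix_eq simp del: One_nat_def atLeastAtMost_iff)
    then show ?thesis by simp
  qed
  have row0: "card {c \<in> {1..n}. perm_matrix n p (r, c) = 0} = n - 1" if r: "r \<in> {1..n}" for r
  proof -
    have "{c \<in> {1..n}. perm_matrix n p (r, c) = 0} = {1..n} - {p r}"
      using r
      by (auto simp: perm_matrix_eq simp del: One_nat_def atLeastAtMost_iff)
    moreover have "p r \<in> {1..n}" using r permutes_in_image[OF p] by blast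
    ultimately show ?thesis by simp
  qed
  have col0: "card {r \<in> {1..n}. perm_matrix n p (r, c) = 0} = n - 1" if c: "c \<in> {1..n}" for c
  proof -
    have "{r \<in> {1..n}. perm_matrix n p (r, c) = 0} = {1..n} - {inv p c}"
      using c permutes_inverses[OF p]
      by (auto simp: perm_matrix_eq simp del: One_nat_def atLeastAtMost_iff)
    moreover have "inv p c \<in> {1..n}" using c permutes_in_image[OF permutes_inv[OF p]] by blast
    ultimately show ?thesis by simp
  qed
  have "perm_matrix n p \<in> {1..n} \<times> {1..n} \<rightarrow>\<^sub>E {..<2}"
    by (auto simp: perm_matrix_def PiE_def extensional_def)
  moreover have "(\<forall>r\<in>{1..n}. card {c \<in> {1..n}. perm_matrix n p (r, c) = s} = [n - 1, 1] ! s) \<and>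
      (\<forall>c\<in>{1..n}. card {r \<in> {1..n}. perm_matrix n p (r, c) = s} = [n - 1, 1] ! s)"
    if "s < 2" for s
  proof (cases "s = 0")
    case True
    show ?thesis unfolding True using row0 col0 by simp
  next
    case False
    with that have s: "s = 1" by simp
    show ?thesis unfolding s using row1 col1 by simp
  qed
  moreover have "n - 1 \<ge> 1" using assms(1) by simp
  ultimately show ?thesis
    by (simp add: frequency_square_def flip: numeral_2_eq_2)
qed

section \<open>Orthogonality to permutation matrices\<close>

lemma perm_matrix_ones:
  assumes "p permutes {1..n}"
  shows "{x \<in> {1..n} \<times> {1..n}. perm_matrix n p x = 1} = (\<lambda>r. (r, p r)) ` {1..n}"
  using permutes_in_image[OF assms]
    by (auto simp: perm_matrix_eq simp del: One_nat_def atLeastAtMost_iff)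

text \<open>Each row has its single 1 at \<open>(r, p r)\<close>, so counting over these cells
  becomes a sum over rows, the form needed later for exchanging sums.\<close>

lemma card_perm_matrix_eq_1:
  assumes "p permutes {1..n}"
  shows "card {x \<in> {1..n} \<times> {1..n}. Q x \<and> perm_matrix n p x = 1}
    = (\<Sum>r=1..n. of_bool (Q (r, p r)))"
proof -
  have "{x \<in> {1..n} \<times> {1..n}. Q x \<and> perm_matrix n p x = 1}
      = (\<lambda>r. (r, p r)) ` {r \<in> {1..n}. Q (r, p r)}"
    using permutes_in_image[OF assms]
    by (auto simp: perm_matrix_eq simp del: One_nat_def atLeastAtMost_iff)
  then have "card {x \<in> {1..n} \<times> {1..n}. Q x \<and> perm_matrix n p x = 1}
      = card {r \<in> {1..n}. Q (r, p r)}"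
    by (simp add: card_image inj_on_def)
  then show ?thesis
    by (simp add: sum.If_cases of_bool_def Int_def)
qed

text \<open>Agreement in one row means exactly one common 1. Since each matrix has \<open>n\<close>
  ones, this number alone fixes all four counts: 1, \<open>n - 1\<close> twice, and the rest by
  inclusion-exclusion.\<close>

lemma fs_orthogonal_perm_matrix:
  assumes "n > 1" and p: "p permutes {1..n}" and q: "q permutes {1..n}"
    and agree: "{r \<in> {1..n}. p r = q r} = {a}"
  shows "fs_orthogonal n (perm_matrix n p) (perm_matrix n q)"
proof -
  define U where "U = {1..n} \<times> {1..n}"
  define A where "A = {x \<in> U. perm_matrix n p x = 1}"
  define B where "B = {x \<in> U. perm_matrix n q x = 1}"
  have card: "card {x \<in> U. perm_matrix n u x = 1} = n" if "u permutes {1..n}" for u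
    unfolding U_def perm_matrix_ones[OF that] by (simp add: card_image inj_on_def)
  have cA: "card A = n" and cB: "card B = n"
    using card p q by (auto simp: A_def B_def)
  have fin: "finite U" "finite A" "finite B" by (auto simp: U_def A_def B_def)
  have AU: "A \<subseteq> U" "B \<subseteq> U" by (auto simp: A_def B_def)
  have "A \<inter> B = (\<lambda>r. (r, p r)) ` {r \<in> {1..n}. p r = q r}"
    unfolding A_def B_def U_def perm_matrix_ones[OF p] perm_matrix_ones[OF q] by auto
  then have AB: "card (A \<inter> B) = 1" using agree by simp
  have cAmB: "card (A - B) = n - 1"
    using AB cA fin by (simp add: card_Diff_subset_Int)
  have cBmA: "card (B - A) = n - 1"
    using AB cB fin by (simp add: card_Diff_subset_Int Int_commute)
  have "card (A \<union> B) = 2 * n - 1"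
    using card_Un_Int[OF fin(2,3)] AB cA cB by simp
  then have "card (U - (A \<union> B)) = n * n - (2 * n - 1)"
    using AU fin by (subst card_Diff_subset) (auto simp: U_def)
  also have "\<dots> = (n - 1) * (n - 1)"
    using assms(1) by (simp add: algebra_simps)
  finally have cUm: "card (U - (A \<union> B)) = (n - 1) * (n - 1)" .
  \<comment> \<open>Rewriting "entry 0" as "entry not 1" turns the four symbol pairs into Boolean
    combinations of \<open>A\<close> and \<open>B\<close>.\<close>
  have bin: "perm_matrix n u x = 0 \<longleftrightarrow> perm_matrix n u x \<noteq> 1" if "x \<in> U" for x u
    using that
    by (auto simp: U_def perm_matrix_eq simp del: One_nat_def atLeastAtMost_iff)
  have "card {x \<in> U. perm_matrix n p x = i \<and> perm_matrix n q x = j}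
      = [n - 1, 1] ! i * [n - 1, 1] ! j"
    if "i < 2" "j < 2" for i j
  proof -
    have "{x \<in> U. perm_matrix n p x = 1 \<and> perm_matrix n q x = 1} = A \<inter> B"
      "{x \<in> U. perm_matrix n p x = 1 \<and> perm_matrix n q x = 0} = A - B"
      "{x \<in> U. perm_matrix n p x = 0 \<and> perm_matrix n q x = 1} = B - A"
      "{x \<in> U. perm_matrix n p x = 0 \<and> perm_matrix n q x = 0} = U - (A \<union> B)"
      by (auto simp: A_def B_def bin)
    then show ?thesis
      using that AB cAmB cBmA cUm by (auto simp: less_2_cases_iff)
  qed
  then show ?thesis
    unfolding fs_orthogonal_def
    using frequency_square_perm_matrix[OF assms(1) p] frequency_square_perm_matrix[OF assms(1) q]
    by (intro exI[of _ "[n - 1, 1]"] conjI) (auto simp: U_def)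
qed

text \<open>This is orthogonality for the pair \<open>(s, 1)\<close>, whose prescribed count is
  \<open>ls ! s * 1\<close>. The types hidden in \<open>fs_orthogonal\<close> are existential, so
  they first have to be matched with \<open>ls\<close> and \<open>[n - 1, 1]\<close> at the two
  symbols concerned.\<close>

lemma frequency_orthogonal_perm_matrix:
  assumes "n > 1" and p: "p permutes {1..n}"
    and orth: "fs_orthogonal n G (perm_matrix n p)" and G: "frequency_square n ls G"
    and s: "s < length ls"
  shows "(\<Sum>r=1..n. of_bool (G (r, p r) = s)) = ls ! s"
proof -
  obtain ls' ms where *: "frequency_square n ls' G" "frequency_square n ms (perm_matrix n p)"
    "\<And>i j. i < length ls' \<Longrightarrow> j < length ms \<Longrightarrow>
      card {x \<in> {1..n} \<times> {1..n}. G x = i \<and> perm_matrix n p x = j} = ls' ! i * ms ! j"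
    using orth unfolding fs_orthogonal_def by blast
  have one: "1 \<in> {1..n}" using assms(1) by simp
  have ms: "1 < length ms" using *(2) by (simp add: frequency_square_def)
  have "ms ! 1 = card {c \<in> {1..n}. perm_matrix n p (1, c) = 1}"
    using *(2) ms one unfolding frequency_square_def by metis
  also have "\<dots> = 1"
    using frequency_square_perm_matrix[OF assms(1) p] one by (auto simp: frequency_square_def)
  finally have ms1: "ms ! 1 = 1" .
  have row: "card {c \<in> {1..n}. G (1, c) = s} = ls ! s"
    using G s one unfolding frequency_square_def by blast
  \<comment> \<open>Positivity makes \<open>s\<close> occur in row 1, so \<open>s\<close> is also a
    symbol for \<open>ls'\<close>; counting it in that row then identifies the two
    frequencies.\<close>
  have "ls ! s > 0"
    using G s by (rule frequency_square_nth_pos)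
  then obtain c where c: "c \<in> {1..n}" "G (1, c) = s"
    using row by (metis (mono_tags, lifting) Collect_empty_eq card.empty less_irrefl)
  have s': "s < length ls'"
    using *(1) c one unfolding frequency_square_def by (auto dest: PiE_mem)
  then have "ls' ! s = ls ! s"
    using *(1) one row unfolding frequency_square_def by metis
  then show ?thesis
    using *(3)[OF s' ms] ms1 card_perm_matrix_eq_1[OF p, of "\<lambda>x. G x = s"] by simp
qed

section \<open>The double count\<close>

lemma cell_1_1_contains_every_symbol:
  fixes p :: "nat \<Rightarrow> nat \<Rightarrow> nat"
  assumes "n > 1" and perm: "\<And>i. p i permutes {1..n}" and fix1: "\<And>i. p i 1 = 1"
    and bij: "\<And>r. r \<in> {2..n} \<Longrightarrow> bij_betw (\<lambda>i. p i r) {0..n-2} {2..n}"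
    and orth: "\<And>i. i \<in> {0..n-2} \<Longrightarrow> fs_orthogonal n G (perm_matrix n (p i))"
    and G: "frequency_square n ls G" and s: "s < length ls"
  shows "G (1, 1) = s"
proof -
  \<comment> \<open>Integer values keep the subtractions below from being truncated.\<close>
  define \<delta> :: "nat \<Rightarrow> nat \<Rightarrow> int" where "\<delta> r c = of_bool (G (r, c) = s)" for r c
  define l where "l = int (ls ! s)"
  have split: "{1..n} = insert 1 {2..n}" using assms(1) by auto
  have count: "(\<Sum>x=1..n. of_bool (Q x)) = int (card {x \<in> {1..n}. Q x})" for Q
    by (simp add: sum.If_cases of_bool_def Int_def)
  have row: "(\<Sum>c=1..n. \<delta> r c) = l" if "r \<in> {1..n}" for r
    using G s that unfolding \<delta>_def count l_def frequency_square_def by simp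
  have col: "(\<Sum>r=1..n. \<delta> r c) = l" if "c \<in> {1..n}" for c
    using G s that unfolding \<delta>_def count l_def frequency_square_def by simp
  have "(\<Sum>r=1..n. \<delta> r (p i r)) = l" if "i \<in> {0..n-2}" for i
    using frequency_orthogonal_perm_matrix[OF assms(1) perm orth[OF that] G s, symmetric]
    by (simp add: \<delta>_def l_def)
  then have "(\<Sum>i=0..n-2. \<Sum>r=1..n. \<delta> r (p i r)) = int (n - 1) * l"
    using assms(1) by (simp add: Suc_diff_Suc numeral_2_eq_2)
  moreover have "(\<Sum>i=0..n-2. \<Sum>r=1..n. \<delta> r (p i r)) = (\<Sum>r=1..n. \<Sum>i=0..n-2. \<delta> r (p i r))"
    by (rule sum.swap)
  moreover have "\<dots> = (\<Sum>i=0..n-2. \<delta> 1 (p i 1)) + (\<Sum>r=2..n. \<Sum>i=0..n-2. \<delta> r (p i r))"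
    unfolding split by simp
  moreover have "(\<Sum>i=0..n-2. \<delta> 1 (p i 1)) = int (n - 1) * \<delta> 1 1"
    using assms(1) by (simp add: fix1[unfolded One_nat_def] Suc_diff_Suc numeral_2_eq_2)
  \<comment> \<open>For fixed \<open>r\<close> in \<open>{2..n}\<close>, the columns
    \<open>p i r\<close> run exactly once through \<open>{2..n}\<close>, so the inner sum is the row
    total without column 1.\<close>
  moreover have "(\<Sum>r=2..n. \<Sum>i=0..n-2. \<delta> r (p i r)) = (\<Sum>r=2..n. l - \<delta> r 1)"
  proof (rule sum.cong[OF refl])
    fix r assume r: "r \<in> {2..n}"
    have "(\<Sum>i=0..n-2. \<delta> r (p i r)) = (\<Sum>c=2..n. \<delta> r c)"
      by (rule sum.reindex_bij_betw[OF bij[OF r]])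
    also have "\<dots> = l - \<delta> r 1"
      using row[of r] r unfolding split by simp
    finally show "(\<Sum>i=0..n-2. \<delta> r (p i r)) = l - \<delta> r 1" .
  qed
  \<comment> \<open>The subtracted terms add up to the total of column 1 without its top
    cell.\<close>
  moreover have "(\<Sum>r=2..n. l - \<delta> r 1) = int (n - 1) * l - (l - \<delta> 1 1)"
    using col[of 1] assms(1) unfolding split by (simp add: sum_subtractf)
  ultimately have "l = int n * \<delta> 1 1"
    using assms(1) by (simp add: algebra_simps)
  moreover have "l > 0"
    using frequency_square_nth_pos[OF G s] by (simp add: l_def)
  ultimately show ?thesis
    by (cases "G (1, 1) = s") (simp_all add: \<delta>_def)
qed

section \<open>Powers of the cycle\<close>

text \<open>Applying the cycle \<open>i\<close> times to its own list rotates the list by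
  \<open>i\<close>. The list has length \<open>n - 1\<close> and holds \<open>2 + k\<close> at
  position \<open>k\<close>, so a power of the cycle is addition modulo \<open>n - 1\<close>,
  shifted by 2.\<close>

lemma funpow_cycle_of_list_upt:
  assumes "k < n - 1"
  shows "(cycle_of_list [2..<Suc n] ^^ i) (2 + k) = 2 + (i + k) mod (n - 1)"
proof -
  have "(cycle_of_list [2..<Suc n] ^^ i) (2 + k)
      = map (cycle_of_list [2..<Suc n] ^^ i) [2..<Suc n] ! k"
    using assms by (simp del: upt_Suc)
  also have "\<dots> = rotate i [2..<Suc n] ! k"
    by (subst cyclic_rotation) auto
  also have "\<dots> = [2..<Suc n] ! ((i + k) mod (n - 1))"
    using assms by (simp add: nth_rotate del: upt_Suc)
  also have "\<dots> = 2 + (i + k) mod (n - 1)"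
    using assms mod_less_divisor[of "n - 1" "i + k"] by (intro nth_upt) linarith
  finally show ?thesis .
qed

theorem theorem2p5:
  fixes n :: nat and \<sigma> :: "nat \<Rightarrow> nat" and F :: "nat \<Rightarrow> nat \<times> nat \<Rightarrow> nat"
  assumes "n > 1" and "squarefree n"
    and "\<sigma> = cycle_of_list [2..<Suc n]"
    and "\<And>i. F i = perm_matrix n (\<sigma> ^^ i)"
  shows "card (F ` {0..n - 2}) = n - 1 \<and>
    (\<forall>i\<in>{0..n - 2}. frequency_square n [n - 1, 1] (F i)) \<and>
    maximal_mofs n (F ` {0..n - 2})"
proof -
  have "\<sigma> permutes {2..n}"
    using cycle_permutes[of "[2..<Suc n]"] assms(3)
    by (simp add: atLeastLessThanSuc_atLeastAtMost del: upt_Suc)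
  then have perm2: "\<sigma> ^^ i permutes {2..n}" for i
    by (rule permutes_funpow)
  then have perm: "\<sigma> ^^ i permutes {1..n}" for i
    by (rule permutes_subset) auto
  have fix1: "(\<sigma> ^^ i) 1 = 1" for i
    using perm2[of i] by (rule permutes_not_in) simp
  \<comment> \<open>Equal images give exponents congruent modulo \<open>n - 1\<close>, and
    \<open>{0..n - 2}\<close> contains each residue once.\<close>
  have inj: "inj_on (\<lambda>i. (\<sigma> ^^ i) r) {0..n - 2}" if r: "r \<in> {2..n}" for r
  proof (rule inj_onI)
    fix i j assume ij: "i \<in> {0..n - 2}" "j \<in> {0..n - 2}" "(\<sigma> ^^ i) r = (\<sigma> ^^ j) r"
    obtain k where k: "r = 2 + k" "k < n - 1"
      using r by (intro that[of "r - 2"]) auto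
    have "(i + k) mod (n - 1) = (j + k) mod (n - 1)"
      using ij(3) k assms(3) funpow_cycle_of_list_upt[OF k(2)] by simp
    then have "[i + k = j + k] (mod (n - 1))"
      by (simp add: cong_def)
    then have "[i = j] (mod (n - 1))"
      by (simp add: cong_add_rcancel_nat)
    then show "i = j"
      using ij(1,2) assms(1) by (auto simp: cong_def)
  qed
  \<comment> \<open>An injective map between sets of the same size \<open>n - 1\<close> is
    onto.\<close>
  have bij: "bij_betw (\<lambda>i. (\<sigma> ^^ i) r) {0..n - 2} {2..n}" if r: "r \<in> {2..n}" for r
  proof -
    have "(\<lambda>i. (\<sigma> ^^ i) r) ` {0..n - 2} \<subseteq> {2..n}"
      using r permutes_in_image[OF perm2] by blast
    moreover have "card ((\<lambda>i. (\<sigma> ^^ i) r) ` {0..n - 2}) = card {2..n}"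
      using assms(1) by (simp add: card_image[OF inj[OF r]])
    ultimately show ?thesis
      using inj[OF r] by (simp add: bij_betw_def card_subset_eq)
  qed
  have inj_F: "inj_on F {0..n - 2}"
  proof (rule inj_onI)
    fix i j assume ij: "i \<in> {0..n - 2}" "j \<in> {0..n - 2}" "F i = F j"
    \<comment> \<open>Row 2 is moved differently by each power, so the position of its 1 recovers
      the exponent.\<close>
    have "(\<sigma> ^^ i) 2 \<in> {1..n}"
      using permutes_in_image[OF perm] assms(1) by simp
    then have "perm_matrix n q (2, (\<sigma> ^^ i) 2) = 1 \<longleftrightarrow> q 2 = (\<sigma> ^^ i) 2" for q
      using assms(1) by (intro perm_matrix_eq) auto
    then have "(\<sigma> ^^ j) 2 = (\<sigma> ^^ i) 2"
      using ij(3) assms(4) by metis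
    then show "i = j"
      using inj_onD[OF inj[of 2]] ij(1,2) assms(1) by simp
  qed
  have fs: "frequency_square n [n - 1, 1] (F i)" for i
    using frequency_square_perm_matrix[OF assms(1) perm] assms(4) by simp
  have "fs_orthogonal n (F i) (F j)"
    if "i \<in> {0..n - 2}" "j \<in> {0..n - 2}" "i \<noteq> j" for i j
  proof -
    \<comment> \<open>In any row of \<open>{2..n}\<close> distinct exponents give distinct columns,
      so the fixed point 1 is the only row of agreement.\<close>
    have "r = 1" if "r \<in> {1..n}" "(\<sigma> ^^ i) r = (\<sigma> ^^ j) r" for r
      using inj_onD[OF inj[of r]] that \<open>i \<in> _\<close> \<open>j \<in> _\<close> \<open>i \<noteq> j\<close> by force
    then have "{r \<in> {1..n}. (\<sigma> ^^ i) r = (\<sigma> ^^ j) r} = {1}"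
      using fix1 assms(1) by auto
    then show ?thesis
      using fs_orthogonal_perm_matrix[OF assms(1) perm perm] assms(4) by simp
  qed
  then have mofs: "mofs n (F ` {0..n - 2})"
    using fs unfolding mofs_def pairwise_def by blast
  have "False" if G: "frequency_square n ls G" and orth: "\<forall>H\<in>F ` {0..n - 2}. fs_orthogonal n G H"
    for G ls
  proof -
    have every: "G (1, 1) = s" if "s < length ls" for s
      using cell_1_1_contains_every_symbol[of n "\<lambda>i. \<sigma> ^^ i", OF assms(1) perm fix1 bij _ G that]
        orth assms(4) by simp
    have "0 < length ls" "1 < length ls"
      using G unfolding frequency_square_def by linarith+
    then show False
      using every zero_neq_one by metis
  qed
  then have "maximal_mofs n (F ` {0..n - 2})"
    using mofs unfolding maximal_mofs_def by blast
  moreover have "card (F ` {0..n - 2}) = n - 1"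
    using assms(1) by (simp add: card_image[OF inj_F])
  ultimately show ?thesis
    using fs by blast
qed

end
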